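(* Let $q\in\mathbb{C}$ with $|q|<1$. Then the following four identities hold: $$\sum_{n=0}^\infty(-1)^n\frac{(-q)_n}{(q;q^2)_{n+1}}q^{\binom{n+1}{2}}=\sum_{n=0}^\infty(-1)^nq^{n(n+1)},$$ $$\sum_{n=0}^\infty(-1)^n\frac{(-q^2;q^2)_n}{(q^{n+1})_{n+1}}q^{\binom{n+1}{2}}=\sum_{n=0}^\infty(-1)^nq^{2n(2n+1)}(1+q^{4n+2}),$$ $$\sum_{n=0}^\infty(-1)^n\frac{(q^3;q^3)_n}{(q)_{2n+1}}q^{\binom{n+1}{2}}=\sum_{n=0}^\infty q^{3n(3n+1)}(1-q^{12n+6}),$$ $$\sum_{n=0}^\infty(-1)^n\frac{(-q^3;q^3)_n}{(q^{n+1})_{n+1}(-q)_n}q^{\binom{n+1}{2}}=\sum_{n=0}^\infty(-1)^nq^{3n(3n+1)}(1+2q^{6n+2}+q^{12n+6}).$$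
   Context: $(a;p)_n=\prod_{j=1}^{n}(1-ap^{j-1})$ for $n\ge0$ (with $(a;p)_0=1$); when the base is omitted it is $q$: $(a)_n=(a;q)_n$. Here $(-1)^n$ is an ordinary power. *)

theory Defs
  imports Complex_Main
begin

definition qpoch :: "complex \<Rightarrow> complex \<Rightarrow> nat \<Rightarrow> complex" where
  "qpoch a p n = (\<Prod>j=1..n. 1 - a * p ^ (j - 1))"

end

theory Submission
  imports Defs "HOL-Analysis.Infinite_Sum"
begin

text \<open>The four identities are the cases \<open>y = -2, 0, -1, 1\<close> of
  \[ \sum_{n \ge 0} (-1)^n q^{n(n+1)/2} \frac{(q)_n}{(q)_{2n+1}} \prod_{j=1}^n (1 - y q^j + q^{2j})
     = \sum_{r \ge 0} c_r(y) q^{r(r+1)}, \]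
  where \<open>c\<^sub>0 = 1\<close>, \<open>c\<^sub>1 = 1 + y\<close> and \<open>c\<^sub>r\<^sub>+\<^sub>2 = y c\<^sub>r\<^sub>+\<^sub>1 - c\<^sub>r\<close>; on the right, two or three consecutive
  terms are grouped. By the finite Jacobi triple product, the product divided by \<open>(q)\<^sub>2\<^sub>n\<^sub>+\<^sub>1\<close>
  is the sum over \<open>r \<le> n\<close> of \<open>(-1)\<^sup>r q\<^bsup>r(r+1)/2\<^esup> c\<^sub>r(y)\<close> divided by \<open>(q)\<^sub>n\<^sub>-\<^sub>r (q)\<^sub>n\<^sub>+\<^sub>r\<^sub>+\<^sub>1\<close>. After interchanging
  the summations, the inner sum over \<open>n\<close> equals \<open>(-1)\<^sup>r q\<^bsup>r(r+1)/2\<^esup>\<close>, which follows by induction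
  on \<open>r\<close> from a telescoping identity.\<close>

section \<open>Elementary bounds for \<open>qpoch\<close> inside the unit disc\<close>

lemma qpoch_0 [simp]: "qpoch a p 0 = 1"
  by (simp add: qpoch_def)

lemma qpoch_Suc: "qpoch a p (Suc n) = qpoch a p n * (1 - a * p ^ n)"
  by (simp add: qpoch_def)

lemma one_minus_mult_power_nonzero:
  fixes a p :: complex
  assumes "norm a < 1" "norm p \<le> 1"
  shows "1 - a * p ^ n \<noteq> 0"
proof
  assume "1 - a * p ^ n = 0"
  then have "norm (a * p ^ n) = 1"
    by (metis eq_iff_diff_eq_0 norm_one)
  moreover have "norm (a * p ^ n) \<le> norm a"
    using assms by (simp add: norm_mult norm_power mult_left_le power_le_one)
  ultimately show False
    using assms by simp
qed

lemma qpoch_nonzero: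
  assumes "norm a < 1" "norm p \<le> 1"
  shows "qpoch a p n \<noteq> 0"
  by (induction n) (use one_minus_mult_power_nonzero[OF assms] in \<open>simp_all add: qpoch_Suc\<close>)

lemma norm_qpoch_le:
  assumes "norm a \<le> 1" "norm p \<le> 1"
  shows "norm (qpoch a p n) \<le> 2 ^ n"
proof (induction n)
  case (Suc n)
  have "norm (a * p ^ n) \<le> 1"
    using assms by (simp add: norm_mult norm_power mult_le_one power_le_one)
  then have "norm (1 - a * p ^ n) \<le> 2"
    using norm_triangle_ineq4[of 1 "a * p ^ n"] by simp
  from mult_mono[OF Suc this] show ?case
    by (simp add: qpoch_Suc norm_mult mult.commute)
qed simp

text \<open>Each factor has norm at least \<open>1 - norm a\<close> by the reverse triangle
  inequality. This crude bound controls the denominators in \<open>bailey_kernel\<close>, because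
  quadratic powers of \<open>q\<close> absorb geometric growth.\<close>

lemma norm_qpoch_ge:
  assumes "norm a < 1" "norm p \<le> 1"
  shows "(1 - norm a) ^ n \<le> norm (qpoch a p n)"
proof (induction n)
  case (Suc n)
  have "norm (a * p ^ n) \<le> norm a"
    using assms by (simp add: norm_mult norm_power mult_left_le power_le_one)
  then have "1 - norm a \<le> norm (1 - a * p ^ n)"
    using norm_triangle_ineq2[of 1 "a * p ^ n"] by simp
  from mult_mono[OF Suc this] show ?case
    using assms by (simp add: qpoch_Suc norm_mult mult.commute)
qed simp

section \<open>Triangular exponents and interchange of summations\<close>

lemma Suc_Suc_choose_two: "Suc (Suc r) choose 2 = Suc r + (Suc r choose 2)"
  by (simp add: numeral_2_eq_2)

lemma power_choose_two_square:
  fixes q :: "'a::comm_monoid_mult"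
  shows "q ^ (Suc r choose 2) * q ^ (Suc r choose 2) = q ^ (r * (r + 1))"
proof -
  have "(Suc r choose 2) + (Suc r choose 2) = r * (r + 1)"
    by (induction r) (simp_all add: Suc_Suc_choose_two)
  then show ?thesis
    by (simp flip: power_add)
qed

text \<open>Consecutive terms have ratio \<open>\<rho> ^ Suc n * B\<close>, which tends to 0, so the
  size of \<open>B\<close> does not matter.\<close>

lemma summable_power_choose_two:
  fixes \<rho> B :: real
  assumes "0 \<le> \<rho>" "\<rho> < 1"
  shows "summable (\<lambda>n. \<rho> ^ (Suc n choose 2) * B ^ n)"
proof -
  have "(\<lambda>n. \<rho> ^ Suc n * \<bar>B\<bar>) \<longlonglongrightarrow> 0"
    using assms by (intro tendsto_mult_left_zero LIMSEQ_Suc LIMSEQ_power_zero) auto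
  then have "eventually (\<lambda>n. \<rho> ^ Suc n * \<bar>B\<bar> < 1/2) sequentially"
    by (rule order_tendstoD) simp
  then obtain N where N: "\<And>n. n \<ge> N \<Longrightarrow> \<rho> ^ Suc n * \<bar>B\<bar> < 1/2"
    by (auto simp: eventually_sequentially)
  show ?thesis
  proof (rule summable_ratio_test[of "1/2" N])
    fix n assume "N \<le> n"
    have "norm (\<rho> ^ (Suc (Suc n) choose 2) * B ^ Suc n) =
        (\<rho> ^ Suc n * \<bar>B\<bar>) * norm (\<rho> ^ (Suc n choose 2) * B ^ n)"
      using assms by (simp add: Suc_Suc_choose_two power_add abs_mult power_abs mult_ac)
    also have "\<dots> \<le> 1/2 * norm (\<rho> ^ (Suc n choose 2) * B ^ n)"
      using N[OF \<open>N \<le> n\<close>] by (intro mult_right_mono) auto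
    finally show "norm (\<rho> ^ (Suc (Suc n) choose 2) * B ^ Suc n) \<le>
        1/2 * norm (\<rho> ^ (Suc n choose 2) * B ^ n)" .
  qed simp
qed

text \<open>The product bound makes the double family absolutely summable, so Fubini for
  \<open>infsum\<close> applies; absolute convergence of rows and columns identifies their ordered
  sums with unordered ones.\<close>

lemma sums_swap_dominated:
  fixes f :: "nat \<Rightarrow> nat \<Rightarrow> 'a::banach"
  assumes g: "summable g" and h: "summable h"
    and le: "\<And>n r. norm (f n r) \<le> g n * h r"
    and nonneg: "\<And>n. 0 \<le> g n" "\<And>r. 0 \<le> h r"
    and row: "\<And>n. f n sums a n"
    and col: "\<And>r. (\<lambda>n. f n r) sums b r"
  shows "summable b" "a sums suminf b"
proof -
  have g': "g summable_on UNIV" and h': "h summable_on UNIV"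
    using g h by (simp_all add: nonneg norm_summable_imp_summable_on)
  have rowabs: "summable (\<lambda>r. norm (f n r))" for n
    using summable_mult[OF h, of "g n"] by (rule summable_comparison_test'[where N = 0]) (simp add: le)
  have colabs: "summable (\<lambda>n. norm (f n r))" for r
    using summable_mult2[OF g, of "h r"] by (rule summable_comparison_test'[where N = 0]) (simp add: le)
  have row': "infsum (f n) UNIV = a n" for n
    using norm_summable_imp_has_sum[OF rowabs row] by (rule infsumI)
  have col': "(\<Sum>\<^sub>\<infinity>n. f n r) = b r" for r
    using norm_summable_imp_has_sum[OF colabs col] by (rule infsumI)
  have rowabs': "(\<lambda>r. norm (f n r)) summable_on UNIV" for n
    using rowabs by (subst summable_on_UNIV_nonneg_real_iff) auto
  have outer: "(\<lambda>n. norm (\<Sum>\<^sub>\<infinity>r. norm (f n r))) summable_on UNIV"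
  proof (rule abs_summable_on_comparison_test')
    show "(\<lambda>n. g n * infsum h UNIV) summable_on UNIV"
      using g' by (rule summable_on_cmult_left)
    fix n
    have "(\<Sum>\<^sub>\<infinity>r. norm (f n r)) \<le> (\<Sum>\<^sub>\<infinity>r. g n * h r)"
      using rowabs' h' by (intro infsum_mono summable_on_cmult_right) (auto simp: le)
    also have "\<dots> = g n * infsum h UNIV"
      using h' by (intro infsum_cmult_right) auto
    finally show "norm (\<Sum>\<^sub>\<infinity>r. norm (f n r)) \<le> g n * infsum h UNIV"
      by (simp add: infsum_nonneg)
  qed
  have "(\<lambda>(n, r). f n r) abs_summable_on UNIV \<times> UNIV"
    unfolding abs_summable_on_Sigma_iff using rowabs' outer by auto
  then have joint: "(\<lambda>(n, r). f n r) summable_on UNIV \<times> UNIV"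
    by (rule abs_summable_summable)
  then have joint': "(\<lambda>(r, n). f n r) summable_on UNIV \<times> UNIV"
    by (subst (asm) summable_on_swap) (simp add: case_prod_unfold)
  have "(\<lambda>n. \<Sum>\<^sub>\<infinity>r. f n r) summable_on UNIV" "(\<lambda>r. \<Sum>\<^sub>\<infinity>n. f n r) summable_on UNIV"
    using summable_on_Sigma_banach[OF joint] summable_on_Sigma_banach[OF joint'] by simp_all
  then have "a summable_on UNIV" "b summable_on UNIV"
    by (simp_all add: row' col')
  then have "a sums infsum a UNIV" "b sums infsum b UNIV"
    by (auto intro: has_sum_imp_sums)
  moreover have "infsum a UNIV = infsum b UNIV"
    using infsum_swap_banach[OF joint] by (simp add: row' col')
  ultimately show "summable b" "a sums suminf b"
    by (auto simp: sums_iff)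
qed

section \<open>The coefficients of the right-hand side\<close>

text \<open>For \<open>y = x + 1/x\<close>, \<open>cheb y r\<close> is the sum of \<open>x ^ j\<close> over \<open>-r \<le> j \<le> r\<close> and \<open>quad_prod y q n\<close>
  (defined below) is \<open>(xq)\<^sub>n (q/x)\<^sub>n\<close>. Working with \<open>y\<close> avoids the roots of unity \<open>x\<close> that belong
  to the values \<open>-2, 0, -1, 1\<close> of \<open>y\<close>.\<close>

fun cheb :: "complex \<Rightarrow> nat \<Rightarrow> complex" where
  "cheb y 0 = 1"
| "cheb y (Suc 0) = 1 + y"
| "cheb y (Suc (Suc r)) = y * cheb y (Suc r) - cheb y r"

text \<open>With \<open>K = norm y + 2\<close> the induction closes because
  \<open>norm y * K + 1 \<le> K * K\<close>.\<close>

lemma norm_cheb_le: "norm (cheb y r) \<le> (norm y + 2) ^ r"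
proof (induction y r rule: cheb.induct)
  case (2 y)
  then show ?case
    using norm_triangle_ineq[of 1 y] by simp
next
  case (3 y r)
  let ?K = "norm y + 2"
  have "norm (cheb y (Suc (Suc r))) \<le> norm y * ?K ^ Suc r + ?K ^ r"
    using norm_triangle_ineq4[of "y * cheb y (Suc r)" "cheb y r"]
      mult_left_mono[OF "3.IH"(1) norm_ge_zero[of y]] "3.IH"(2)
    by (simp add: norm_mult)
  also have "\<dots> = ?K ^ r * (norm y * ?K + 1)"
    by (simp add: algebra_simps)
  also have "\<dots> \<le> ?K ^ r * (?K * ?K)"
    by (intro mult_left_mono) (simp_all add: algebra_simps)
  finally show ?case
    by (simp add: mult_ac)
qed simp

text \<open>Since y c_r = c_(r+1) + c_(r-1), multiplication by \<open>y\<close> moves from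
  \<open>cheb\<close> to a second-neighbour sum of \<open>g\<close>. The term
  \<open>g 1 - g 0\<close> comes from extending the recurrence downwards by c_(-1) = -1.\<close>

lemma sum_cheb_by_parts:
  fixes g :: "nat \<Rightarrow> complex"
  shows "y * (\<Sum>r\<le>m. cheb y r * g r) =
    (g 1 - g 0) + (\<Sum>r<m. cheb y (Suc r) * (g r + g (r + 2)))
      + cheb y (Suc m) * g m - cheb y m * g (Suc m)"
proof (induction m)
  case (Suc m)
  have "y * (\<Sum>r\<le>Suc m. cheb y r * g r) =
      y * (\<Sum>r\<le>m. cheb y r * g r) + (cheb y (Suc (Suc m)) + cheb y m) * g (Suc m)"
    by (simp add: algebra_simps)
  then show ?case
    unfolding Suc by (simp add: algebra_simps)
qed (simp add: algebra_simps)

section \<open>The finite Jacobi triple product\<close>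

definition quad_prod :: "complex \<Rightarrow> complex \<Rightarrow> nat \<Rightarrow> complex" where
  "quad_prod y q n = (\<Prod>j=1..n. 1 - y * q ^ j + q ^ (2 * j))"

lemma quad_prod_0 [simp]: "quad_prod y q 0 = 1"
  by (simp add: quad_prod_def)

lemma quad_prod_Suc:
  "quad_prod y q (Suc n) = quad_prod y q n * (1 - y * q ^ Suc n + q ^ (2 * n + 2))"
  by (simp add: quad_prod_def)

text \<open>Up to the constant factor \<open>1 - q\<close>, this is the kernel of Bailey pairs
  relative to a = q. The case \<open>n < r\<close> is set to 0 explicitly because
  \<open>n - r\<close> is truncated subtraction.\<close>

definition bailey_kernel :: "complex \<Rightarrow> nat \<Rightarrow> nat \<Rightarrow> complex" where
  "bailey_kernel q n r =
    (if r \<le> n then 1 / (qpoch q q (n - r) * qpoch q q (n + r + 1)) else 0)"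

lemma bailey_kernel_eq_0: "n < r \<Longrightarrow> bailey_kernel q n r = 0"
  by (simp add: bailey_kernel_def)

context
  fixes q :: complex
  assumes q: "norm q < 1"
begin

lemma one_minus_power_nonzero [simp]: "1 - q * q ^ n \<noteq> 0" "1 - q ^ Suc n \<noteq> 0"
  using one_minus_mult_power_nonzero[of q q n] q by auto

lemma qpoch_self_nonzero [simp]: "qpoch q q n \<noteq> 0"
  using q by (intro qpoch_nonzero) auto

lemma bailey_kernel_Suc_right:
  "bailey_kernel q n (Suc r) = bailey_kernel q n r * (1 - q ^ (n - r)) / (1 - q ^ Suc (n + r + 1))"
proof (cases "r < n")
  case True
  then obtain k where "n = r + Suc k"
    using less_imp_Suc_add by auto
  then show ?thesis
    using one_minus_power_nonzero(2)[of k] one_minus_power_nonzero(2)[of "2 * r + Suc k + 1"]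
    by (simp add: bailey_kernel_def qpoch_Suc)
qed (auto simp: bailey_kernel_def)

lemma bailey_kernel_Suc_Suc:
  "bailey_kernel q (Suc n) (Suc r) =
    bailey_kernel q n r / ((1 - q ^ Suc (n + r + 1)) * (1 - q ^ Suc (n + r + 2)))"
  by (simp add: bailey_kernel_def qpoch_Suc)

lemma bailey_kernel_Suc_left:
  "r \<le> n \<Longrightarrow> bailey_kernel q (Suc n) r =
    bailey_kernel q n r / ((1 - q ^ Suc (n - r)) * (1 - q ^ Suc (n + r + 1)))"
  by (simp add: bailey_kernel_def qpoch_Suc Suc_diff_le)

text \<open>This is the coefficient form of multiplying the product by its next factor
  \<open>(1 + q ^ (2 * n + 2)) - y * q ^ Suc n\<close>: the part containing \<open>y\<close> becomes
  the neighbour sum of \<open>sum_cheb_by_parts\<close>.\<close>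

lemma bailey_kernel_recurrence:
  fixes n :: nat
  defines "g \<equiv> \<lambda>n r. (-1) ^ r * q ^ (Suc r choose 2) * bailey_kernel q n r"
  shows "(1 - q ^ (2 * n + 2)) * (1 - q ^ (2 * n + 3)) * g (Suc n) 0 =
      (1 + q ^ (2 * n + 2)) * g n 0 - q ^ Suc n * (g n 1 - g n 0)" (is ?A)
    and "(1 - q ^ (2 * n + 2)) * (1 - q ^ (2 * n + 3)) * g (Suc n) (Suc r) =
      (1 + q ^ (2 * n + 2)) * g n (Suc r) - q ^ Suc n * (g n r + g n (r + 2))" (is ?B)
proof -
  define x where "x = q ^ n"
  have nz: "1 - q * x \<noteq> 0" "1 - q * (q * x) \<noteq> 0"
    using one_minus_power_nonzero(1)[of n] one_minus_power_nonzero(1)[of "Suc n"]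
    by (simp_all add: x_def)
  have x2: "q ^ (2 * n) = x * x"
    by (simp add: x_def power_add mult_2)
  show ?A
    using nz unfolding g_def
    by (simp add: bailey_kernel_Suc_left bailey_kernel_Suc_right power_add x2 numeral_2_eq_2
          numeral_3_eq_3 flip: x_def, simp add: divide_simps, algebra)
  show ?B
  proof (cases "r \<le> n")
    case True
    then obtain k where n: "n = r + k"
      using le_Suc_ex by blast
    define v where "v = q ^ Suc r"
    define T where "T = (-1) ^ r * q ^ (Suc r choose 2)"
    define K where "K = bailey_kernel q n r"
    show ?thesis
    \<comment> \<open>At \<open>r = n\<close> the entries at \<open>r + 1\<close> and
      \<open>r + 2\<close> vanish. For \<open>r < n\<close> all entries are multiples of
      \<open>T * K\<close>, and a rational identity in \<open>v\<close>, \<open>t\<close> and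
      \<open>q\<close> remains.\<close>
    proof (cases k)
      case 0
      have nz: "1 - v * v \<noteq> 0" "1 - v * v * q \<noteq> 0"
        using one_minus_power_nonzero(2)[of "2 * r + 1"] one_minus_power_nonzero(2)[of "2 * r + 2"]
        by (simp_all add: v_def power_add mult_2 mult_2_right mult_ac)
      have "g (Suc n) (Suc r) = - T * v * K / ((1 - v * v) * (1 - v * v * q))"
        using 0 n by (simp add: g_def T_def v_def K_def bailey_kernel_Suc_Suc Suc_Suc_choose_two power_add mult_ac)
      moreover have "g n (Suc r) = 0" "g n (r + 2) = 0" "g n r = T * K"
        using 0 n by (simp_all add: g_def T_def K_def bailey_kernel_eq_0)
      moreover have "q ^ (2 * n + 2) = v * v" "q ^ (2 * n + 3) = v * v * q" "q ^ Suc n = v"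
        using 0 n by (simp_all add: v_def power_add mult_2 mult_2_right mult_ac numeral_3_eq_3)
      ultimately show ?thesis
        using nz by simp
    next
      case (Suc j)
      define t where "t = q ^ j"
      have nz: "1 - v * v * q * t \<noteq> 0" "1 - v * v * q * q * t \<noteq> 0"
        using one_minus_power_nonzero(2)[of "2 * r + j + 2"] one_minus_power_nonzero(2)[of "2 * r + j + 3"]
        by (simp_all add: v_def t_def power_add mult_2 mult_2_right mult_ac numeral_3_eq_3)
      have pw: "q ^ Suc (n + r + 1) = v * v * q * t" "q ^ Suc (n + r + 2) = v * v * q * q * t"
        "q ^ Suc (n + Suc r + 1) = v * v * q * q * t" "q ^ (n - r) = q * t" "q ^ (n - Suc r) = t"
        using Suc n by (simp_all add: v_def t_def power_add mult_ac)
      have vals1: "g (Suc n) (Suc r) = - T * v * K / ((1 - v * v * q * t) * (1 - v * v * q * q * t))"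
        unfolding g_def bailey_kernel_Suc_Suc pw
        by (simp add: T_def v_def K_def Suc_Suc_choose_two power_add mult_ac)
      have vals2: "g n (Suc r) = - T * v * K * (1 - q * t) / (1 - v * v * q * t)"
        unfolding g_def bailey_kernel_Suc_right pw
        by (simp add: T_def v_def K_def Suc_Suc_choose_two power_add mult_ac)
      have vals3: "g n (r + 2) = T * v * v * q * K * (1 - q * t) * (1 - t) /
          ((1 - v * v * q * t) * (1 - v * v * q * q * t))"
        unfolding g_def add_2_eq_Suc' bailey_kernel_Suc_right pw
        by (simp add: T_def v_def K_def Suc_Suc_choose_two power_add mult_ac)
      have vals4: "g n r = T * K"
        by (simp add: g_def T_def K_def)
      have vals5: "q ^ (2 * n + 2) = v * v * q * q * t * t"
        "q ^ (2 * n + 3) = v * v * q * q * q * t * t" "q ^ Suc n = v * q * t"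
        using Suc n by (simp_all add: v_def t_def power_add mult_2 mult_2_right mult_ac numeral_3_eq_3)
      show ?thesis
        unfolding vals1 vals2 vals3 vals4 vals5 using nz by (simp add: divide_simps) algebra
    qed
  qed (auto simp: g_def bailey_kernel_eq_0)
qed

lemma finite_triple_product:
  "quad_prod y q n / qpoch q q (2 * n + 1) =
    (\<Sum>r\<le>n. cheb y r * ((-1) ^ r * q ^ (Suc r choose 2) * bailey_kernel q n r))"
proof (induction n)
  case 0
  show ?case
    by (simp add: bailey_kernel_def numeral_2_eq_2)
next
  case (Suc n)
  define g where "g = (\<lambda>n r. (-1) ^ r * q ^ (Suc r choose 2) * bailey_kernel q n r)"
  \<comment> \<open>\<open>P\<close> is the quotient of the denominators for \<open>Suc n\<close>
    and \<open>n\<close>.\<close>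
  define P where "P = (1 - q ^ (2 * n + 2)) * (1 - q ^ (2 * n + 3))"
  have "P \<noteq> 0"
    using one_minus_power_nonzero(2)[of "2 * n + 1"] one_minus_power_nonzero(2)[of "2 * n + 2"]
    by (simp add: P_def numeral_3_eq_3)
  have g0: "g n r = 0" if "n < r" for r
    using that by (simp add: g_def bailey_kernel_eq_0)
  \<comment> \<open>The range includes the vanishing term at \<open>Suc n\<close>, so that both
    boundary terms of the summation by parts are zero.\<close>
  define S where "S = (\<Sum>r\<le>Suc n. cheb y r * g n r)"
  have S: "S = quad_prod y q n / qpoch q q (2 * n + 1)"
    using g0[of "Suc n"] unfolding Suc S_def by (simp add: g_def)
  have "P * (\<Sum>r\<le>Suc n. cheb y r * g (Suc n) r) =
      P * g (Suc n) 0 + (\<Sum>r\<le>n. cheb y (Suc r) * (P * g (Suc n) (Suc r)))"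
    by (simp add: sum.atMost_Suc_shift sum_distrib_left algebra_simps del: sum.atMost_Suc)
  also have "\<dots> = (1 + q ^ (2 * n + 2)) * g n 0 - q ^ Suc n * (g n 1 - g n 0) +
      (\<Sum>r\<le>n. cheb y (Suc r) * ((1 + q ^ (2 * n + 2)) * g n (Suc r) - q ^ Suc n * (g n r + g n (r + 2))))"
    unfolding P_def g_def bailey_kernel_recurrence ..
  also have "\<dots> = (1 + q ^ (2 * n + 2)) * S -
      q ^ Suc n * ((g n 1 - g n 0) + (\<Sum>r<Suc n. cheb y (Suc r) * (g n r + g n (r + 2))))"
    unfolding S_def lessThan_Suc_atMost sum.atMost_Suc_shift
    by (simp add: algebra_simps sum_distrib_left sum_subtractf sum.distrib del: sum.atMost_Suc)
  also have "\<dots> = (1 + q ^ (2 * n + 2)) * S - q ^ Suc n * (y * S)"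
    unfolding S_def sum_cheb_by_parts by (simp add: g0)
  also have "\<dots> = quad_prod y q (Suc n) / qpoch q q (2 * n + 1)"
    unfolding S quad_prod_Suc by (simp add: algebra_simps add_divide_distrib diff_divide_distrib)
  finally have "(\<Sum>r\<le>Suc n. cheb y r * g (Suc n) r) =
      quad_prod y q (Suc n) / (qpoch q q (2 * n + 1) * P)"
    using \<open>P \<noteq> 0\<close> by (simp add: field_simps del: sum.atMost_Suc)
  also have "qpoch q q (2 * n + 1) * P = qpoch q q (2 * Suc n + 1)"
    by (simp add: P_def qpoch_Suc numeral_3_eq_3 mult_ac)
  finally show ?case
    by (simp only: g_def)
qed

section \<open>The inner sums over n and the identity for general \<open>y\<close>\<close>

definition conj_term :: "nat \<Rightarrow> nat \<Rightarrow> complex" where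
  "conj_term n r = (-1) ^ n * q ^ (Suc n choose 2) * qpoch q q n * bailey_kernel q n r"

text \<open>The lower bounds for the two denominators multiply to
  \<open>(1 - norm q) ^ (2 * n + 1)\<close>, in which \<open>r\<close> cancels. Uniformity in
  \<open>r\<close> is what the domination of the double series requires.\<close>

lemma norm_conj_term_le:
  "norm (conj_term n r) \<le>
    norm q ^ (Suc n choose 2) * (2 / (1 - norm q)\<^sup>2) ^ n / (1 - norm q)"
proof (cases "r \<le> n")
  case True
  let ?d = "1 - norm q"
  have d: "0 < ?d"
    using q by simp
  have "?d ^ (n - r) * ?d ^ (n + r + 1) \<le>
      norm (qpoch q q (n - r)) * norm (qpoch q q (n + r + 1))"
    using q d by (intro mult_mono norm_qpoch_ge) auto
  moreover have "?d ^ (n - r) * ?d ^ (n + r + 1) = (?d\<^sup>2) ^ n * ?d"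
    using True by (simp flip: power_add power_mult power_Suc2 add: mult_2)
  ultimately have "(?d\<^sup>2) ^ n * ?d \<le> norm (qpoch q q (n - r)) * norm (qpoch q q (n + r + 1))"
    by (simp only:)
  then have "norm (bailey_kernel q n r) \<le> 1 / ((?d\<^sup>2) ^ n * ?d)"
    using True d by (simp add: bailey_kernel_def norm_divide norm_mult frac_le del: One_nat_def)
  moreover have "norm (qpoch q q n) \<le> 2 ^ n"
    using q by (intro norm_qpoch_le) auto
  ultimately have "norm (qpoch q q n) * norm (bailey_kernel q n r) \<le> 2 ^ n * (1 / ((?d\<^sup>2) ^ n * ?d))"
    using d by (intro mult_mono) auto
  then have "norm q ^ (Suc n choose 2) * (norm (qpoch q q n) * norm (bailey_kernel q n r)) \<le>
      norm q ^ (Suc n choose 2) * (2 ^ n * (1 / ((?d\<^sup>2) ^ n * ?d)))"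
    by (intro mult_left_mono) auto
  then show ?thesis
    by (simp add: conj_term_def norm_mult norm_power power_divide mult_ac)
next
  case False
  then show ?thesis
    using q by (simp add: conj_term_def bailey_kernel_eq_0)
qed

lemma summable_conj_bound:
  "summable (\<lambda>n. norm q ^ (Suc n choose 2) * (2 / (1 - norm q)\<^sup>2) ^ n / (1 - norm q))"
  using q by (intro summable_divide summable_power_choose_two) auto

lemma conj_term_tendsto_0: "(\<lambda>n. conj_term n r) \<longlonglongrightarrow> 0"
  by (rule tendsto_0_le[OF summable_LIMSEQ_zero[OF summable_conj_bound], where K = 1])
    (use norm_conj_term_le q in \<open>auto intro!: always_eventually\<close>)

text \<open>The sequences \<open>u\<close> and \<open>W\<close> in the proof are WZ certificates.\<close>

lemma conj_term_sums: "(\<lambda>n. conj_term n r) sums ((-1) ^ r * q ^ (Suc r choose 2))"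
proof (induction r)
  case 0
  define u where "u = (\<lambda>n. (1 - q ^ Suc n) * conj_term n 0)"
  have "(\<lambda>n. 1 - q ^ Suc n) \<longlonglongrightarrow> 1 - 0"
    using q by (intro tendsto_diff tendsto_const LIMSEQ_Suc LIMSEQ_power_zero)
  then have "u \<longlonglongrightarrow> 0"
    unfolding u_def using tendsto_mult[OF _ conj_term_tendsto_0] by fastforce
  then have "(\<lambda>n. u n - u (Suc n)) sums (u 0 - 0)"
    by (rule telescope_sums')
  moreover have "u n - u (Suc n) = conj_term n 0" for n
  proof -
    define x where "x = q ^ n"
    have nz: "1 - q * x \<noteq> 0" "1 - q * (q * x) \<noteq> 0"
      using one_minus_power_nonzero(1)[of n] one_minus_power_nonzero(1)[of "Suc n"]
      by (simp_all add: x_def)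
    show ?thesis
      using nz by (simp add: u_def conj_term_def bailey_kernel_Suc_left qpoch_Suc
          Suc_Suc_choose_two power_add divide_simps flip: x_def) algebra
  qed
  moreover have "u 0 = 1"
    using one_minus_power_nonzero(2)[of 0]
    by (simp add: u_def conj_term_def bailey_kernel_def qpoch_Suc numeral_2_eq_2)
  ultimately show ?case
    by (simp add: numeral_2_eq_2)
next
  case (Suc r)
  define W where "W = (\<lambda>n. (1 + q ^ Suc r) * (1 - q ^ (n - r)) * conj_term n r)"
  have "(\<lambda>n. q ^ (n - r)) \<longlonglongrightarrow> 0"
    by (rule LIMSEQ_offset[where k = r]) (use q in \<open>simp add: LIMSEQ_power_zero\<close>)
  then have "(\<lambda>n. (1 + q ^ Suc r) * (1 - q ^ (n - r))) \<longlonglongrightarrow> (1 + q ^ Suc r) * (1 - 0)"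
    by (intro tendsto_intros)
  then have "W \<longlonglongrightarrow> 0"
    unfolding W_def using tendsto_mult[OF _ conj_term_tendsto_0] by fastforce
  then have "(\<lambda>n. W n - W (Suc n)) sums (W 0 - 0)"
    by (rule telescope_sums')
  \<comment> \<open>Truncated subtraction gives \<open>0 - r = 0\<close>, so the factor
    \<open>1 - q ^ (0 - r)\<close> vanishes.\<close>
  moreover have "W 0 = 0"
    by (simp add: W_def)
  moreover have "W n - W (Suc n) = conj_term n (Suc r) + q ^ Suc r * conj_term n r" for n
  proof (cases "r \<le> n")
    case True
    then obtain k where n: "n = r + k"
      using le_Suc_ex by blast
    define v t where "v = q ^ r" and "t = q ^ k"
    have nz: "1 - q * t \<noteq> 0" "1 - q * q * v * v * t \<noteq> 0"
      using one_minus_power_nonzero(2)[of k] one_minus_power_nonzero(2)[of "2 * r + k + 1"]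
      by (simp_all add: v_def t_def power_add mult_2 mult_2_right mult_ac)
    have pw: "q ^ Suc (n + r + 1) = q * q * v * v * t" "q ^ (n - r) = t" "q ^ Suc (n - r) = q * t"
      "q ^ (Suc n - r) = q * t" "q ^ n = v * t"
      using n by (simp_all add: v_def t_def power_add mult_ac Suc_diff_le)
    define K where "K = (-1) ^ n * q ^ (Suc n choose 2) * qpoch q q n * bailey_kernel q n r"
    have "conj_term (Suc n) r = - K * (q * v * t) * (1 - q * v * t) / ((1 - q * t) * (1 - q * q * v * v * t))"
      unfolding conj_term_def bailey_kernel_Suc_left[OF True] pw
      by (simp add: K_def qpoch_Suc Suc_Suc_choose_two power_add pw mult_ac)
    moreover have "conj_term n (Suc r) = K * (1 - t) / (1 - q * q * v * v * t)"
      unfolding conj_term_def bailey_kernel_Suc_right pw by (simp add: K_def)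
    moreover have "conj_term n r = K"
      by (simp add: K_def conj_term_def)
    ultimately show ?thesis
      using nz unfolding W_def pw by (simp add: divide_simps flip: v_def) algebra
  next
    case False
    then show ?thesis
      \<comment> \<open>At \<open>Suc n = r\<close> the term \<open>W (Suc n)\<close> vanishes
        through its factor \<open>1 - q ^ 0\<close>; below that, through the kernel.\<close>
      by (cases "Suc n = r") (auto simp: W_def conj_term_def bailey_kernel_eq_0)
  qed
  \<comment> \<open>Hence the sum for \<open>Suc r\<close> is \<open>- (q ^ Suc r)\<close> times the
    sum for \<open>r\<close>.\<close>
  ultimately have "(\<lambda>n. conj_term n (Suc r) + q ^ Suc r * conj_term n r) sums 0"
    by simp
  from sums_diff[OF this sums_mult[OF Suc, of "q ^ Suc r"]] show ?case
    by (simp add: Suc_Suc_choose_two power_add mult_ac)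
qed

text \<open>Row sums come from \<open>finite_triple_product\<close>, column sums from
  \<open>conj_term_sums\<close>. In each column the two signs cancel and the two triangular powers
  combine to \<open>q ^ (r * (r + 1))\<close>.\<close>

theorem quad_prod_sums:
  "summable (\<lambda>r. cheb y r * q ^ (r * (r + 1)))" (is ?A)
  "(\<lambda>n. (-1) ^ n * (qpoch q q n * quad_prod y q n / qpoch q q (2 * n + 1)) * q ^ (Suc n choose 2))
    sums (\<Sum>r. cheb y r * q ^ (r * (r + 1)))" (is ?B)
proof -
  define f where "f = (\<lambda>n r. cheb y r * ((-1) ^ r * q ^ (Suc r choose 2)) * conj_term n r)"
  define g where "g = (\<lambda>n. norm q ^ (Suc n choose 2) * (2 / (1 - norm q)\<^sup>2) ^ n / (1 - norm q))"
  \<comment> \<open>The triangular power from the triple product dominates the growth of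
    \<open>cheb y r\<close>; the one in \<open>g\<close> handles the growth in
    \<open>n\<close>.\<close>
  define h where "h = (\<lambda>r. norm q ^ (Suc r choose 2) * (norm y + 2) ^ r)"
  have g: "summable g" "0 \<le> g n" for n
    using summable_conj_bound q by (auto simp: g_def)
  have h: "summable h" "0 \<le> h r" for r
    using q by (auto simp: h_def intro!: summable_power_choose_two)
  have le: "norm (f n r) \<le> g n * h r" for n r
  proof -
    have "norm (f n r) = norm (conj_term n r) * (norm q ^ (Suc r choose 2) * norm (cheb y r))"
      by (simp add: f_def norm_mult norm_power mult_ac)
    also have "\<dots> \<le> g n * h r"
      using norm_conj_term_le[of n r] g(2)[of n] unfolding g_def h_def
      by (intro mult_mono norm_cheb_le order_refl) auto
    finally show ?thesis .
  qed
  have row: "f n sums ((-1) ^ n * (qpoch q q n * quad_prod y q n / qpoch q q (2 * n + 1)) * q ^ (Suc n choose 2))"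
    for n
  proof -
    have "f n sums (\<Sum>r\<le>n. f n r)"
      by (rule sums_finite) (auto simp: f_def conj_term_def bailey_kernel_eq_0)
    also have "(\<Sum>r\<le>n. f n r) =
        (-1) ^ n * q ^ (Suc n choose 2) * qpoch q q n * (quad_prod y q n / qpoch q q (2 * n + 1))"
      unfolding finite_triple_product sum_distrib_left
      by (intro sum.cong) (simp_all add: f_def conj_term_def mult_ac)
    finally show ?thesis
      by (simp add: mult_ac)
  qed
  have col: "(\<lambda>n. f n r) sums (cheb y r * q ^ (r * (r + 1)))" for r
  proof -
    have "(\<lambda>n. f n r) sums (cheb y r * ((-1) ^ r * q ^ (Suc r choose 2)) * ((-1) ^ r * q ^ (Suc r choose 2)))"
      unfolding f_def by (intro sums_mult conj_term_sums)
    also have "cheb y r * ((-1) ^ r * q ^ (Suc r choose 2)) * ((-1) ^ r * q ^ (Suc r choose 2)) =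
        cheb y r * (((-1) ^ r * (-1) ^ r) * (q ^ (Suc r choose 2) * q ^ (Suc r choose 2)))"
      by (simp only: mult_ac)
    also have "\<dots> = cheb y r * q ^ (r * (r + 1))"
      unfolding power_choose_two_square by (simp flip: power_mult_distrib)
    finally show ?thesis .
  qed
  show ?A ?B
    using sums_swap_dominated[OF g(1) h(1) le g(2) h(2) row col] by auto
qed

text \<open>Keeping \<open>t\<close> and \<open>s\<close> abstract reduces each special case to two
  termwise identities.\<close>

lemma quad_prod_sums_group:
  assumes k: "0 < k"
    and t: "\<And>n. t n = (\<Sum>r=n*k..<n*k+k. cheb y r * q ^ (r * (r + 1)))"
    and s: "\<And>n. s n = qpoch q q n * quad_prod y q n / qpoch q q (2 * n + 1)"
  shows "summable t \<and> (\<lambda>n. (-1) ^ n * s n * q ^ ((n + 1) choose 2)) sums suminf t"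
proof -
  have "t sums (\<Sum>r. cheb y r * q ^ (r * (r + 1)))"
    unfolding t by (rule sums_group[OF summable_sums[OF quad_prod_sums(1)] k])
  then show ?thesis
    using quad_prod_sums(2)[of y] by (auto simp: s sums_iff)
qed

end

section \<open>Products and coefficients at the four values of \<open>y\<close>\<close>

lemma qpoch_square_base:
  "qpoch (q\<^sup>2) (q\<^sup>2) n = qpoch q q n * qpoch (- q) q n"
  by (induction n) (simp_all add: qpoch_Suc algebra_simps power2_eq_square power_mult_distrib)

text \<open>The factors of \<open>qpoch q q (2 * n + 1)\<close> are sorted by the parity of the
  exponent.\<close>

lemma qpoch_odd_times_even:
  "qpoch q (q\<^sup>2) (n + 1) * qpoch (q\<^sup>2) (q\<^sup>2) n = qpoch q q (2 * n + 1)"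
proof (induction n)
  case (Suc n)
  have "qpoch q (q\<^sup>2) (Suc n + 1) * qpoch (q\<^sup>2) (q\<^sup>2) (Suc n) =
      (qpoch q (q\<^sup>2) (n + 1) * qpoch (q\<^sup>2) (q\<^sup>2) n) *
        (1 - q ^ Suc (2 * n + 1)) * (1 - q ^ Suc (2 * n + 2))"
    by (simp add: qpoch_Suc mult_ac power2_eq_square power_mult_distrib mult_2 mult_2_right power_add)
  then show ?case
    unfolding Suc by (simp add: qpoch_Suc)
qed (simp add: qpoch_Suc)

lemma qpoch_add: "qpoch a p (m + n) = qpoch a p m * qpoch (a * p ^ m) p n"
  by (induction n) (simp_all add: qpoch_Suc power_add mult_ac)

text \<open>The new factor is a quadratic in z = \<open>q * q ^ n\<close>, ready to be factored for
  each special \<open>y\<close>.\<close>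

lemma quad_prod_Suc_square:
  "quad_prod y q (Suc n) = quad_prod y q n * (1 - y * (q * q ^ n) + (q * q ^ n)\<^sup>2)"
proof -
  have "q ^ (2 * n + 2) = (q * q ^ n)\<^sup>2"
    by (simp add: mult.commute flip: power_Suc power_mult)
  then show ?thesis
    by (simp only: quad_prod_Suc power_Suc)
qed

lemma quad_prod_minus_2: "quad_prod (-2) q n = (qpoch (- q) q n)\<^sup>2"
proof (induction n)
  case (Suc n)
  have "1 - (-2) * (q * q ^ n) + (q * q ^ n)\<^sup>2 = (1 - (- q) * q ^ n)\<^sup>2"
    by algebra
  then show ?case
    by (simp only: Suc quad_prod_Suc_square qpoch_Suc power_mult_distrib)
qed simp

lemma quad_prod_0_left: "quad_prod 0 q n = qpoch (- (q\<^sup>2)) (q\<^sup>2) n"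
proof (induction n)
  case (Suc n)
  have "(q * q ^ n)\<^sup>2 = q\<^sup>2 * (q\<^sup>2) ^ n"
    by (simp add: power2_eq_square power_mult_distrib mult_ac)
  then show ?case
    by (simp add: Suc quad_prod_Suc_square qpoch_Suc)
qed simp

text \<open>The extra \<open>qpoch q q n\<close> supplies the factors 1 - z that complete 1 + z +
  z^2 to 1 - z^3.\<close>

lemma quad_prod_minus_1: "qpoch q q n * quad_prod (-1) q n = qpoch (q ^ 3) (q ^ 3) n"
proof (induction n)
  case (Suc n)
  have "qpoch q q (Suc n) * quad_prod (-1) q (Suc n) =
      (qpoch q q n * quad_prod (-1) q n) * ((1 - q * q ^ n) * (1 + q * q ^ n + (q * q ^ n)\<^sup>2))"
    by (simp add: quad_prod_Suc_square qpoch_Suc mult_ac)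
  also have "(1 - q * q ^ n) * (1 + q * q ^ n + (q * q ^ n)\<^sup>2) = 1 - (q * q ^ n) ^ 3"
    by algebra
  also have "(q * q ^ n) ^ 3 = q ^ 3 * (q ^ 3) ^ n"
    by (simp add: power3_eq_cube power_mult_distrib mult_ac)
  finally show ?case
    by (simp add: Suc qpoch_Suc)
qed simp

text \<open>Here the factors 1 + z complete 1 - z + z^2 to 1 + z^3.\<close>

lemma quad_prod_1: "qpoch (- q) q n * quad_prod 1 q n = qpoch (- (q ^ 3)) (q ^ 3) n"
proof (induction n)
  case (Suc n)
  have "qpoch (- q) q (Suc n) * quad_prod 1 q (Suc n) =
      (qpoch (- q) q n * quad_prod 1 q n) * ((1 + q * q ^ n) * (1 - q * q ^ n + (q * q ^ n)\<^sup>2))"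
    by (simp add: quad_prod_Suc_square qpoch_Suc mult_ac)
  also have "(1 + q * q ^ n) * (1 - q * q ^ n + (q * q ^ n)\<^sup>2) = 1 + (q * q ^ n) ^ 3"
    by algebra
  also have "(q * q ^ n) ^ 3 = q ^ 3 * (q ^ 3) ^ n"
    by (simp add: power3_eq_cube power_mult_distrib mult_ac)
  finally show ?case
    by (simp add: Suc qpoch_Suc)
qed simp

lemma cheb_minus_2: "cheb (-2) r = (-1) ^ r"
proof -
  \<comment> \<open>The recurrence has order two, so the induction carries two consecutive
    values.\<close>
  have "cheb (-2) r = (-1) ^ r \<and> cheb (-2) (Suc r) = (-1) ^ Suc r"
    by (induction r) simp_all
  then show ?thesis ..
qed

text \<open>Here x = i, and the coefficients 1, 1, -1, -1 repeat with period 4.\<close>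

lemma cheb_0: "cheb 0 (2 * n) = (-1) ^ n \<and> cheb 0 (Suc (2 * n)) = (-1) ^ n"
  by (induction n) simp_all

text \<open>Here x is a primitive cube root of unity, which gives period 3.\<close>

lemma cheb_minus_1:
  "cheb (-1) (3 * n) = 1 \<and> cheb (-1) (Suc (3 * n)) = 0 \<and> cheb (-1) (Suc (Suc (3 * n))) = -1"
  by (induction n) (simp_all add: numeral_3_eq_3)

text \<open>Here x is a primitive sixth root of unity: the coefficients change sign after every
  three steps.\<close>

lemma cheb_1:
  "cheb 1 (3 * n) = (-1) ^ n \<and> cheb 1 (Suc (3 * n)) = 2 * (-1) ^ n \<and>
    cheb 1 (Suc (Suc (3 * n))) = (-1) ^ n"
  by (induction n) (simp_all add: numeral_3_eq_3)

theorem corollary3p4: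
  fixes q :: complex
  assumes "norm q < 1"
  shows
    "(summable (\<lambda>n::nat. (-1) ^ n * q ^ (n * (n + 1))) \<and>
      (\<lambda>n::nat. (-1) ^ n * (qpoch (- q) q n / qpoch q (q ^ 2) (n + 1)) * q ^ ((n + 1) choose 2))
        sums (\<Sum>n. (-1) ^ n * q ^ (n * (n + 1)))) \<and>
     (summable (\<lambda>n::nat. (-1) ^ n * q ^ (2 * n * (2 * n + 1)) * (1 + q ^ (4 * n + 2))) \<and>
      (\<lambda>n::nat. (-1) ^ n * (qpoch (- (q ^ 2)) (q ^ 2) n / qpoch (q ^ (n + 1)) q (n + 1)) * q ^ ((n + 1) choose 2))
        sums (\<Sum>n. (-1) ^ n * q ^ (2 * n * (2 * n + 1)) * (1 + q ^ (4 * n + 2)))) \<and>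
     (summable (\<lambda>n::nat. q ^ (3 * n * (3 * n + 1)) * (1 - q ^ (12 * n + 6))) \<and>
      (\<lambda>n::nat. (-1) ^ n * (qpoch (q ^ 3) (q ^ 3) n / qpoch q q (2 * n + 1)) * q ^ ((n + 1) choose 2))
        sums (\<Sum>n. q ^ (3 * n * (3 * n + 1)) * (1 - q ^ (12 * n + 6)))) \<and>
     (summable (\<lambda>n::nat. (-1) ^ n * q ^ (3 * n * (3 * n + 1)) * (1 + 2 * q ^ (6 * n + 2) + q ^ (12 * n + 6))) \<and>
      (\<lambda>n::nat. (-1) ^ n * (qpoch (- (q ^ 3)) (q ^ 3) n / (qpoch (q ^ (n + 1)) q (n + 1) * qpoch (- q) q n)) * q ^ ((n + 1) choose 2))
        sums (\<Sum>n. (-1) ^ n * q ^ (3 * n * (3 * n + 1)) * (1 + 2 * q ^ (6 * n + 2) + q ^ (12 * n + 6))))"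
\<comment> \<open>The instantiation splits only between the identities and keeps each summability
  claim with its sum.\<close>
proof (intro conjI[of "summable _ \<and> _"])
  have nz: "qpoch q q n \<noteq> 0" "qpoch (- q) q n \<noteq> 0" for n
    using assms by (simp_all add: qpoch_nonzero)
  have mid: "qpoch q q (2 * n + 1) = qpoch q q n * qpoch (q ^ (n + 1)) q (n + 1)" for n
    using qpoch_add[of q q n "n + 1"] by (simp add: mult_2)
  have group2: "(\<Sum>r=n*2..<n*2+2. F r) = F (2 * n) + F (Suc (2 * n))"
    and group3: "(\<Sum>r=n*3..<n*3+3. F r) = F (3 * n) + F (Suc (3 * n)) + F (Suc (Suc (3 * n)))"
    for F :: "nat \<Rightarrow> complex" and n
    by (simp_all add: numeral_2_eq_2 numeral_3_eq_3 mult.commute)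
  show "summable (\<lambda>n::nat. (-1) ^ n * q ^ (n * (n + 1))) \<and>
      (\<lambda>n::nat. (-1) ^ n * (qpoch (- q) q n / qpoch q (q ^ 2) (n + 1)) * q ^ ((n + 1) choose 2))
        sums (\<Sum>n. (-1) ^ n * q ^ (n * (n + 1)))"
  proof (rule quad_prod_sums_group[OF assms, where k = 1 and y = "-2"])
    fix n
    show "qpoch (- q) q n / qpoch q (q\<^sup>2) (n + 1) =
        qpoch q q n * quad_prod (- 2) q n / qpoch q q (2 * n + 1)"
      \<comment> \<open>The even factors give \<open>qpoch q q n * qpoch (- q) q n\<close>, which
        cancels all but one \<open>qpoch (- q) q n\<close> of the numerator.\<close>
      unfolding qpoch_odd_times_even[symmetric] qpoch_square_base quad_prod_minus_2
      using nz[of n] by (simp add: power2_eq_square)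
  qed (simp_all add: cheb_minus_2)
  show "summable (\<lambda>n::nat. (-1) ^ n * q ^ (2 * n * (2 * n + 1)) * (1 + q ^ (4 * n + 2))) \<and>
      (\<lambda>n::nat. (-1) ^ n * (qpoch (- (q ^ 2)) (q ^ 2) n / qpoch (q ^ (n + 1)) q (n + 1)) * q ^ ((n + 1) choose 2))
        sums (\<Sum>n. (-1) ^ n * q ^ (2 * n * (2 * n + 1)) * (1 + q ^ (4 * n + 2)))"
  proof (rule quad_prod_sums_group[OF assms, where k = 2 and y = 0])
    fix n
    show "(-1) ^ n * q ^ (2 * n * (2 * n + 1)) * (1 + q ^ (4 * n + 2)) =
        (\<Sum>r=n*2..<n*2+2. cheb 0 r * q ^ (r * (r + 1)))"
    proof -
      have "Suc (2 * n) * (Suc (2 * n) + 1) = 2 * n * (2 * n + 1) + (4 * n + 2)"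
        by (simp add: algebra_simps)
      then show ?thesis
        by (simp only: group2 cheb_0 power_add) (simp add: algebra_simps)
    qed
    show "qpoch (- (q\<^sup>2)) (q\<^sup>2) n / qpoch (q ^ (n + 1)) q (n + 1) =
        qpoch q q n * quad_prod 0 q n / qpoch q q (2 * n + 1)"
      unfolding mid quad_prod_0_left using nz[of n] by simp
  qed simp
  show "summable (\<lambda>n::nat. q ^ (3 * n * (3 * n + 1)) * (1 - q ^ (12 * n + 6))) \<and>
      (\<lambda>n::nat. (-1) ^ n * (qpoch (q ^ 3) (q ^ 3) n / qpoch q q (2 * n + 1)) * q ^ ((n + 1) choose 2))
        sums (\<Sum>n. q ^ (3 * n * (3 * n + 1)) * (1 - q ^ (12 * n + 6)))"
  proof (rule quad_prod_sums_group[OF assms, where k = 3 and y = "-1"])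
    fix n
    show "q ^ (3 * n * (3 * n + 1)) * (1 - q ^ (12 * n + 6)) =
        (\<Sum>r=n*3..<n*3+3. cheb (-1) r * q ^ (r * (r + 1)))"
    proof -
      \<comment> \<open>Only the third exponent of the group is needed, as the middle coefficient is
        0.\<close>
      have "Suc (Suc (3 * n)) * (Suc (Suc (3 * n)) + 1) = 3 * n * (3 * n + 1) + (12 * n + 6)"
        by (simp add: algebra_simps)
      then show ?thesis
        by (simp only: group3 cheb_minus_1 power_add) (simp add: algebra_simps)
    qed
    show "qpoch (q ^ 3) (q ^ 3) n / qpoch q q (2 * n + 1) =
        qpoch q q n * quad_prod (- 1) q n / qpoch q q (2 * n + 1)"
      unfolding quad_prod_minus_1 ..
  qed simp
  show "summable (\<lambda>n::nat. (-1) ^ n * q ^ (3 * n * (3 * n + 1)) * (1 + 2 * q ^ (6 * n + 2) + q ^ (12 * n + 6))) \<and>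
      (\<lambda>n::nat. (-1) ^ n * (qpoch (- (q ^ 3)) (q ^ 3) n / (qpoch (q ^ (n + 1)) q (n + 1) * qpoch (- q) q n)) * q ^ ((n + 1) choose 2))
        sums (\<Sum>n. (-1) ^ n * q ^ (3 * n * (3 * n + 1)) * (1 + 2 * q ^ (6 * n + 2) + q ^ (12 * n + 6)))"
  proof (rule quad_prod_sums_group[OF assms, where k = 3 and y = 1])
    fix n
    show "(-1) ^ n * q ^ (3 * n * (3 * n + 1)) * (1 + 2 * q ^ (6 * n + 2) + q ^ (12 * n + 6)) =
        (\<Sum>r=n*3..<n*3+3. cheb 1 r * q ^ (r * (r + 1)))"
    proof -
      have "Suc (3 * n) * (Suc (3 * n) + 1) = 3 * n * (3 * n + 1) + (6 * n + 2)"
        "Suc (Suc (3 * n)) * (Suc (Suc (3 * n)) + 1) = 3 * n * (3 * n + 1) + (12 * n + 6)"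
        by (simp_all add: algebra_simps)
      then show ?thesis
        by (simp only: group3 cheb_1 power_add) (simp add: algebra_simps)
    qed
    show "qpoch (- (q ^ 3)) (q ^ 3) n / (qpoch (q ^ (n + 1)) q (n + 1) * qpoch (- q) q n) =
        qpoch q q n * quad_prod 1 q n / qpoch q q (2 * n + 1)"
      unfolding mid quad_prod_1[symmetric] using nz[of n] by simp
  qed simp
qed

end
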